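(* Let $A$ be a product diagonalizable operator on $\mathcal{H}_{m_1}\otimes\mathcal{H}_{m_2}\otimes\dots\otimes\mathcal{H}_{m_k}$, where $\mathcal{H}_{m_r}=\mathbb{C}^{m_r}$ with standard orthonormal basis $|0\rangle,\dots,|m_r-1\rangle$. Let $\Sigma$ be a diagonal matrix obtained from $A$ by conjugation with a product unitary $U_{1}\otimes U_{2}\otimes\dots\otimes U_{k}$, and put $$\lambda_{l_1,l_2,\dots,l_k}=\langle l_1,l_2,\dots,l_k|\Sigma|l_1,l_2,\dots,l_k\rangle,\qquad 0\le l_r\le m_r-1.$$ Then $\Lambda^{\otimes}(A)$ is exactly the set of all complex numbers of the form $$\sum_{l_1=0}^{m_1-1}\sum_{l_2=0}^{m_2-1}\dots\sum_{l_k=0}^{m_k-1}p^{(1)}_{l_1}p^{(2)}_{l_2}\cdots p^{(k)}_{l_k}\,\lambda_{l_1,l_2,\dots,l_k},$$ where, for each $r=1,\dots,k$, $p^{(r)}_0,\dots,p^{(r)}_{m_r-1}\ge 0$ and $p^{(r)}_0+\dots+p^{(r)}_{m_r-1}=1$.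
   Context: For an operator $X$ on $\mathcal{H}_{m_1}\otimes\dots\otimes\mathcal{H}_{m_k}$, the product numerical range is $\Lambda^{\otimes}(X)=\{\langle\psi_1\otimes\dots\otimes\psi_k|X|\psi_1\otimes\dots\otimes\psi_k\rangle : \psi_r\in\mathcal{H}_{m_r},\ \|\psi_r\|=1,\ r=1,\dots,k\}$. The operator $A$ is called product diagonalizable if there exist unitary matrices $U_r$ of size $m_r\times m_r$, $r=1,\dots,k$, such that $(U_1\otimes\dots\otimes U_k)A(U_1\otimes\dots\otimes U_k)^\dagger=\Sigma$ is a diagonal matrix in the product basis $|l_1,\dots,l_k\rangle=|l_1\rangle\otimes\dots\otimes|l_k\rangle$. *)

theory Defs
  imports Complex_Main "HOL-Library.FuncSet" "Jordan_Normal_Form.Schur_Decomposition"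
begin

text \<open>
  The tensor factors are indexed by \<open>r < k\<close>, and \<open>m r\<close> is the dimension of factor \<open>r\<close>.
  The tensor product of the spaces \<open>\<complex>^(m r)\<close> is \<open>\<complex>^N\<close> with \<open>N = (\<Prod>r<k. m r)\<close>, where the product
  basis is enumerated lexicographically (the last factor varies fastest).
\<close>

definition kron_vec :: "complex vec \<Rightarrow> complex vec \<Rightarrow> complex vec" where
  "kron_vec v w =
     vec (dim_vec v * dim_vec w) (\<lambda>i. v $ (i div dim_vec w) * w $ (i mod dim_vec w))"

definition kron_mat :: "complex mat \<Rightarrow> complex mat \<Rightarrow> complex mat" where
  "kron_mat A B =
     mat (dim_row A * dim_row B) (dim_col A * dim_col B)
       (\<lambda>(i, j). A $$ (i div dim_row B, j div dim_col B) * B $$ (i mod dim_row B, j mod dim_col B))"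

primrec tensor_vec :: "nat \<Rightarrow> (nat \<Rightarrow> complex vec) \<Rightarrow> complex vec" where
  "tensor_vec 0 \<psi> = vec 1 (\<lambda>_. 1)"
| "tensor_vec (Suc k) \<psi> = kron_vec (tensor_vec k \<psi>) (\<psi> k)"

primrec tensor_mat :: "nat \<Rightarrow> (nat \<Rightarrow> complex mat) \<Rightarrow> complex mat" where
  "tensor_mat 0 U = 1\<^sub>m 1"
| "tensor_mat (Suc k) U = kron_mat (tensor_mat k U) (U k)"

definition tensor_dim :: "nat \<Rightarrow> (nat \<Rightarrow> nat) \<Rightarrow> nat" where
  "tensor_dim k m = (\<Prod>r<k. m r)"

definition multi_indices :: "nat \<Rightarrow> (nat \<Rightarrow> nat) \<Rightarrow> (nat \<Rightarrow> nat) set" where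
  "multi_indices k m = (\<Pi>\<^sub>E r\<in>{..<k}. {..<m r})"

definition product_ket :: "nat \<Rightarrow> (nat \<Rightarrow> nat) \<Rightarrow> (nat \<Rightarrow> nat) \<Rightarrow> complex vec" where
  "product_ket k m l = tensor_vec k (\<lambda>r. unit_vec (m r) (l r))"

text \<open>The scalar product \<open>v \<bullet>c w\<close> conjugates its second argument.\<close>

definition braket :: "complex vec \<Rightarrow> complex mat \<Rightarrow> complex vec \<Rightarrow> complex" where
  "braket \<phi> X \<psi> = (X *\<^sub>v \<psi>) \<bullet>c \<phi>"

definition cvec_norm :: "complex vec \<Rightarrow> real" where
  "cvec_norm v = sqrt (\<Sum>i<dim_vec v. (cmod (v $ i))\<^sup>2)"

definition unitary_mat :: "nat \<Rightarrow> complex mat \<Rightarrow> bool" where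
  "unitary_mat n U \<longleftrightarrow>
     U \<in> carrier_mat n n \<and> U * mat_adjoint U = 1\<^sub>m n \<and> mat_adjoint U * U = 1\<^sub>m n"

definition product_numerical_range :: "nat \<Rightarrow> (nat \<Rightarrow> nat) \<Rightarrow> complex mat \<Rightarrow> complex set" where
  "product_numerical_range k m X =
     {braket (tensor_vec k \<psi>) X (tensor_vec k \<psi>) | \<psi>.
        \<forall>r<k. \<psi> r \<in> carrier_vec (m r) \<and> cvec_norm (\<psi> r) = 1}"

definition product_diagonalizes ::
    "nat \<Rightarrow> (nat \<Rightarrow> nat) \<Rightarrow> (nat \<Rightarrow> complex mat) \<Rightarrow> complex mat \<Rightarrow> complex mat \<Rightarrow> bool" where
  "product_diagonalizes k m U A S \<longleftrightarrow>
     (\<forall>r<k. unitary_mat (m r) (U r)) \<and>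
     tensor_mat k U * A * mat_adjoint (tensor_mat k U) = S \<and> diagonal_mat S"

definition product_diagonalizable :: "nat \<Rightarrow> (nat \<Rightarrow> nat) \<Rightarrow> complex mat \<Rightarrow> bool" where
  "product_diagonalizable k m A \<longleftrightarrow> (\<exists>U S. product_diagonalizes k m U A S)"

end

theory Submission
  imports Defs
begin

text \<open>
  The adjoint of \<open>U\<^sub>1 \<otimes> \<dots> \<otimes> U\<^sub>k\<close> maps product vectors to product vectors and preserves the norm of
  every factor, so \<open>A\<close> and \<open>\<Sigma>\<close> have the same product numerical range.  For the diagonal matrix
  \<open>\<Sigma>\<close> the expectation value at \<open>\<phi>\<^sub>1 \<otimes> \<dots> \<otimes> \<phi>\<^sub>k\<close> is the combination of the diagonal entries with
  weights \<open>\<Prod>r. |\<phi>\<^sub>r(l\<^sub>r)|^2\<close>, and the squared moduli of the coordinates of unit vectors are exactly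
  the probability vectors.
\<close>

subsection \<open>Matrices and scalar products\<close>

lemma mult_mat_vec_index_sum:
  "i < dim_row A \<Longrightarrow> dim_vec v = dim_col A \<Longrightarrow>
    (A *\<^sub>v v) $ i = (\<Sum>j<dim_col A. A $$ (i, j) * v $ j)"
  by (simp add: scalar_prod_def atLeast0LessThan)

lemma cscalar_prod_sum:
  "dim_vec w = n \<Longrightarrow> v \<bullet>c w = (\<Sum>i<n. v $ i * conjugate (w $ i))"
  by (simp add: scalar_prod_def atLeast0LessThan)

lemma mat_adjoint_dim [simp]:
  "dim_row (mat_adjoint A) = dim_col A" "dim_col (mat_adjoint A) = dim_row A"
  by (simp_all add: mat_adjoint_def)

lemma mat_adjoint_index [simp]:
  "i < dim_col A \<Longrightarrow> j < dim_row A \<Longrightarrow> mat_adjoint A $$ (i, j) = conjugate (A $$ (j, i))"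
  by (simp add: mat_adjoint_def mat_of_rows_index)

lemma mat_adjoint_carrier [simp]:
  "A \<in> carrier_mat n m \<Longrightarrow> mat_adjoint A \<in> carrier_mat m n"
  by (intro carrier_matI) auto

lemma mat_adjoint_mat_adjoint [simp]: "mat_adjoint (mat_adjoint A) = A"
  by (rule eq_matI) auto

text \<open>Both sides expand to one double sum, taken in the two orders. This is what moves an
  operator from the ket to the bra.\<close>

lemma mult_mat_vec_cscalar_prod:
  fixes A :: "complex mat"
  assumes "A \<in> carrier_mat n m" "v \<in> carrier_vec m" "w \<in> carrier_vec n"
  shows "(A *\<^sub>v v) \<bullet>c w = v \<bullet>c (mat_adjoint A *\<^sub>v w)"
proof -
  have "(A *\<^sub>v v) \<bullet>c w = (\<Sum>i<n. \<Sum>j<m. A $$ (i, j) * v $ j * conjugate (w $ i))"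
    using assms
    by (subst cscalar_prod_sum[where n = n])
      (auto simp: mult_mat_vec_index_sum sum_distrib_right simp del: index_mult_mat_vec intro!: sum.cong)
  also have "\<dots> = (\<Sum>j<m. \<Sum>i<n. A $$ (i, j) * v $ j * conjugate (w $ i))"
    by (rule sum.swap)
  also have "\<dots> = v \<bullet>c (mat_adjoint A *\<^sub>v w)"
    using assms
    by (subst cscalar_prod_sum[where n = m])
      (auto simp: mult_mat_vec_index_sum sum_distrib_left mult_ac simp del: index_mult_mat_vec intro!: sum.cong)
  finally show ?thesis .
qed

section \<open>Norms, unitary matrices and expectation values\<close>

lemma cvec_norm_cscalar_prod: "complex_of_real ((cvec_norm v)\<^sup>2) = v \<bullet>c v"
proof -
  have "(cvec_norm v)\<^sup>2 = (\<Sum>i<dim_vec v. (cmod (v $ i))\<^sup>2)"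
    by (simp add: cvec_norm_def sum_nonneg)
  then show ?thesis
    by (simp only: cscalar_prod_sum[OF refl] conjugate_complex_def of_real_sum complex_norm_square)
qed

lemma unitary_mat_adjoint: "unitary_mat n U \<Longrightarrow> unitary_mat n (mat_adjoint U)"
  by (auto simp: unitary_mat_def)

text \<open>Moving one \<open>U\<close> across the scalar product turns it into its adjoint, which
  cancels against the other \<open>U\<close>.\<close>

lemma cvec_norm_unitary:
  assumes "unitary_mat n U" "v \<in> carrier_vec n"
  shows "cvec_norm (U *\<^sub>v v) = cvec_norm v"
proof -
  have U: "U \<in> carrier_mat n n" and inv: "mat_adjoint U * U = 1\<^sub>m n"
    using assms by (auto simp: unitary_mat_def)
  have "(U *\<^sub>v v) \<bullet>c (U *\<^sub>v v) = v \<bullet>c (mat_adjoint U *\<^sub>v (U *\<^sub>v v))"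
    using U assms by (intro mult_mat_vec_cscalar_prod) auto
  also have "mat_adjoint U *\<^sub>v (U *\<^sub>v v) = v"
    using U assms inv by (subst assoc_mult_mat_vec[symmetric]) auto
  finally have "(cvec_norm (U *\<^sub>v v))\<^sup>2 = (cvec_norm v)\<^sup>2"
    by (simp only: of_real_eq_iff flip: cvec_norm_cscalar_prod)
  moreover have "0 \<le> cvec_norm x" for x
    by (simp add: cvec_norm_def sum_nonneg)
  ultimately show ?thesis
    by (simp add: power2_eq_iff_nonneg)
qed

text \<open>The left factor \<open>T\<close> passes to the bra as its adjoint, while the right
  factor acts on the ket. Conjugating the operator thus amounts to changing the vector.\<close>

lemma braket_conjugate_mat:
  fixes T X :: "complex mat"
  assumes "T \<in> carrier_mat n n" "X \<in> carrier_mat n n" "w \<in> carrier_vec n"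
  shows "braket w (T * X * mat_adjoint T) w = braket (mat_adjoint T *\<^sub>v w) X (mat_adjoint T *\<^sub>v w)"
proof -
  have "mat_adjoint T *\<^sub>v w \<in> carrier_vec n"
    using assms by (intro mult_mat_vec_carrier[of _ n n]) auto
  moreover from this
  have *: "(T * X * mat_adjoint T) *\<^sub>v w = T *\<^sub>v (X *\<^sub>v (mat_adjoint T *\<^sub>v w))"
    using assms by (simp add: assoc_mult_mat_vec[of _ n n _ n])
  ultimately show ?thesis
    unfolding braket_def * using assms
    by (intro mult_mat_vec_cscalar_prod[of _ n n]) auto
qed

text \<open>\<open>S\<close> rescales coordinate \<open>i\<close> by its diagonal entry there, and
  \<open>v $ i\<close> times its conjugate is a squared modulus, so phases drop out.\<close>

lemma braket_diagonal:
  assumes "diagonal_mat S" "S \<in> carrier_mat n n" "v \<in> carrier_vec n"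
  shows "braket v S v = (\<Sum>i<n. of_real ((cmod (v $ i))\<^sup>2) * S $$ (i, i))"
proof -
  have "(S *\<^sub>v v) $ i = S $$ (i, i) * v $ i" if "i < n" for i
  proof -
    have "(S *\<^sub>v v) $ i = (\<Sum>j<n. S $$ (i, j) * v $ j)"
      using assms(2,3) that by (subst mult_mat_vec_index_sum) auto
    also have "\<dots> = (\<Sum>j<n. if j = i then S $$ (i, i) * v $ i else 0)"
      using assms that by (intro sum.cong) (auto simp: diagonal_mat_def)
    finally show ?thesis
      using that by simp
  qed
  then show ?thesis
    unfolding braket_def using assms
    by (subst cscalar_prod_sum[where n = n])
      (auto simp: complex_norm_square mult_ac simp del: index_mult_mat_vec of_real_power intro!: sum.cong)
qed

subsection \<open>Tensor products\<close>

lemma mult_add_less_mult: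
  fixes x y :: nat
  assumes "x < a" "y < b"
  shows "x * b + y < a * b"
proof -
  have "x * b + y < Suc x * b"
    using assms by simp
  also have "\<dots> \<le> a * b"
    using assms by (intro mult_le_mono1) simp
  finally show ?thesis .
qed

lemma mult_add_div [simp]:
  fixes x y :: nat
  assumes "y < b"
  shows "(x * b + y) div b = x"
  using assms by (subst div_mult_self3) auto

lemma div_mod_less_mult:
  fixes i :: nat
  assumes "i < a * b"
  shows "i div b < a" "i mod b < b"
  \<comment> \<open>The case \<open>b = 0\<close> contradicts \<open>i < a * b\<close>; otherwise
    the remainder bound holds.\<close>
  using assms by (simp add: less_mult_imp_div_less) (use assms in \<open>cases b; simp\<close>)

text \<open>Division with remainder by \<open>b\<close> is a bijection from the indices below
  \<open>a * b\<close> to pairs: \<open>x\<close> selects a block and \<open>y\<close> the place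
  inside it, as in \<open>kron_vec\<close>.\<close>

lemma sum_lessThan_mult:
  fixes f :: "nat \<Rightarrow> 'a::comm_monoid_add"
  shows "(\<Sum>i<a * b. f i) = (\<Sum>x<a. \<Sum>y<b. f (x * b + y))"
  unfolding sum.cartesian_product
  by (rule sum.reindex_bij_witness[where i = "\<lambda>(x, y). x * b + y" and j = "\<lambda>i. (i div b, i mod b)"])
    (auto simp: div_mod_less_mult mult_add_less_mult)

section \<open>Kronecker products of two factors\<close>

lemma kron_vec_dim [simp]: "dim_vec (kron_vec v w) = dim_vec v * dim_vec w"
  by (simp add: kron_vec_def)

lemma kron_mat_dim [simp]:
  "dim_row (kron_mat A B) = dim_row A * dim_row B"
  "dim_col (kron_mat A B) = dim_col A * dim_col B"
  by (simp_all add: kron_mat_def)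

lemma kron_vec_index [simp]:
  "x < dim_vec v \<Longrightarrow> y < dim_vec w \<Longrightarrow> kron_vec v w $ (x * dim_vec w + y) = v $ x * w $ y"
  by (simp add: kron_vec_def mult_add_less_mult)

text \<open>The mixed-product rule: the sum over columns becomes a sum over pairs whose terms
  separate, so it factors into the two matrix-vector products.\<close>

lemma kron_mat_mult_kron_vec:
  assumes "dim_col A = dim_vec v" "dim_col B = dim_vec w"
  shows "kron_mat A B *\<^sub>v kron_vec v w = kron_vec (A *\<^sub>v v) (B *\<^sub>v w)"
proof (rule eq_vecI)
  fix i assume "i < dim_vec (kron_vec (A *\<^sub>v v) (B *\<^sub>v w))"
  then have i: "i < dim_row A * dim_row B"
    by simp
  note i' = div_mod_less_mult[OF i]
  have "(kron_mat A B *\<^sub>v kron_vec v w) $ i =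
      (\<Sum>x<dim_vec v. \<Sum>y<dim_vec w.
        A $$ (i div dim_row B, x) * B $$ (i mod dim_row B, y) * (v $ x * w $ y))"
    using i assms
    by (auto simp: mult_mat_vec_index_sum sum_lessThan_mult kron_mat_def mult_add_less_mult
        simp del: index_mult_mat_vec intro!: sum.cong)
  also have "\<dots> = (A *\<^sub>v v) $ (i div dim_row B) * (B *\<^sub>v w) $ (i mod dim_row B)"
    using i' assms
    by (simp add: mult_mat_vec_index_sum sum_product mult_ac del: index_mult_mat_vec)
  also have "\<dots> = kron_vec (A *\<^sub>v v) (B *\<^sub>v w) $ i"
    using i by (simp add: kron_vec_def)
  finally show "(kron_mat A B *\<^sub>v kron_vec v w) $ i = kron_vec (A *\<^sub>v v) (B *\<^sub>v w) $ i" .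
qed simp

lemma mat_adjoint_kron_mat:
  "mat_adjoint (kron_mat A B) = kron_mat (mat_adjoint A) (mat_adjoint B)"
  by (rule eq_matI) (auto simp: kron_mat_def div_mod_less_mult)

lemma mat_adjoint_one: "mat_adjoint (1\<^sub>m n :: complex mat) = 1\<^sub>m n"
  by (rule eq_matI) auto

text \<open>Ensures that the adjoint of a product operator still acts factor by factor on product
  vectors.\<close>

lemma mat_adjoint_tensor_mat:
  "mat_adjoint (tensor_mat k U) = tensor_mat k (\<lambda>r. mat_adjoint (U r))"
  by (induction k) (simp_all add: mat_adjoint_one mat_adjoint_kron_mat)

section \<open>Iterated tensor products\<close>

lemma tensor_dim_simps [simp]:
  "tensor_dim 0 m = 1" "tensor_dim (Suc k) m = tensor_dim k m * m k"
  by (simp_all add: tensor_dim_def)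

lemma tensor_vec_carrier:
  "\<forall>r<k. \<psi> r \<in> carrier_vec (m r) \<Longrightarrow> tensor_vec k \<psi> \<in> carrier_vec (tensor_dim k m)"
proof (induction k)
  case (Suc k)
  then have "tensor_vec k \<psi> \<in> carrier_vec (tensor_dim k m)" "\<psi> k \<in> carrier_vec (m k)"
    by auto
  then show ?case
    by (intro carrier_vecI) auto
qed (auto intro: carrier_vecI)

lemma tensor_mat_carrier:
  "\<forall>r<k. U r \<in> carrier_mat (m r) (m r) \<Longrightarrow>
    tensor_mat k U \<in> carrier_mat (tensor_dim k m) (tensor_dim k m)"
proof (induction k)
  case (Suc k)
  then have "tensor_mat k U \<in> carrier_mat (tensor_dim k m) (tensor_dim k m)"
    "U k \<in> carrier_mat (m k) (m k)"
    by auto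
  then show ?case
    by (intro carrier_matI) auto
qed simp

lemma tensor_vec_cong:
  "(\<And>r. r < k \<Longrightarrow> \<phi> r = \<psi> r) \<Longrightarrow> tensor_vec k \<phi> = tensor_vec k \<psi>"
  by (induction k) auto

lemma tensor_mat_mult_tensor_vec:
  assumes "\<forall>r<k. U r \<in> carrier_mat (m r) (m r)" "\<forall>r<k. \<psi> r \<in> carrier_vec (m r)"
  shows "tensor_mat k U *\<^sub>v tensor_vec k \<psi> = tensor_vec k (\<lambda>r. U r *\<^sub>v \<psi> r)"
  using assms
proof (induction k)
  case (Suc k)
  have "tensor_mat k U \<in> carrier_mat (tensor_dim k m) (tensor_dim k m)"
    "tensor_vec k \<psi> \<in> carrier_vec (tensor_dim k m)"
    using Suc.prems by (auto intro!: tensor_mat_carrier tensor_vec_carrier)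
  then have "tensor_mat (Suc k) U *\<^sub>v tensor_vec (Suc k) \<psi> =
      kron_vec (tensor_mat k U *\<^sub>v tensor_vec k \<psi>) (U k *\<^sub>v \<psi> k)"
    using Suc.prems by (simp add: kron_mat_mult_kron_vec carrier_matD[of _ "m k" "m k"] carrier_vecD[of _ "m k"])
  then show ?case
    using Suc by simp
qed simp

subsection \<open>The lexicographic enumeration of the product basis\<close>

text \<open>Horner evaluation of a mixed-radix numeral with digits \<open>l r\<close> and radices
  \<open>m r\<close>, the last digit least significant. It gives the position of a product basis
  vector in the ordering built by \<open>tensor_vec\<close>.\<close>

primrec lex_index :: "nat \<Rightarrow> (nat \<Rightarrow> nat) \<Rightarrow> (nat \<Rightarrow> nat) \<Rightarrow> nat" where
  "lex_index 0 m l = 0"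
| "lex_index (Suc k) m l = lex_index k m l * m k + l k"

lemma lex_index_cong:
  "(\<And>r. r < k \<Longrightarrow> l r = l' r) \<Longrightarrow> lex_index k m l = lex_index k m l'"
  by (induction k) auto

lemma lex_index_less: "\<forall>r<k. l r < m r \<Longrightarrow> lex_index k m l < tensor_dim k m"
  by (induction k) (auto intro: mult_add_less_mult)

text \<open>Serves as the bijection between positions and multi-indices. The range is cut into
  blocks of length \<open>m k\<close>, and each shorter multi-index is extended by a last digit
  \<open>y\<close>.\<close>

lemma sum_lex_index:
  "(\<Sum>i<tensor_dim k m. f i) = (\<Sum>l\<in>multi_indices k m. f (lex_index k m l))"
\<comment> \<open>The induction hypothesis is applied to the block sums, which form a different
  function, hence the generalisation over \<open>f\<close>.\<close>
proof (induction k arbitrary: f)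
  case 0
  show ?case
    by (simp add: multi_indices_def)
next
  case (Suc k)
  have "(\<Sum>i<tensor_dim (Suc k) m. f i) =
      (\<Sum>l\<in>multi_indices k m. \<Sum>y<m k. f (lex_index k m l * m k + y))"
    by (simp add: sum_lessThan_mult Suc)
  also have "\<dots> = (\<Sum>y<m k. \<Sum>l\<in>multi_indices k m. f (lex_index (Suc k) m (l(k := y))))"
  proof (subst sum.swap, intro sum.cong refl)
    fix y l
    have "lex_index k m (l(k := y)) = lex_index k m l"
      by (rule lex_index_cong) simp
    then show "f (lex_index k m l * m k + y) = f (lex_index (Suc k) m (l(k := y)))"
      by simp
  qed
  \<comment> \<open>Elements of \<open>multi_indices k m\<close> all take the same default value at
    \<open>k\<close>, so \<open>l\<close> and \<open>y\<close> can be recovered from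
    \<open>l(k := y)\<close> and the reindexing is injective.\<close>
  also have "\<dots> = (\<Sum>l\<in>(\<lambda>(y, l). l(k := y)) ` ({..<m k} \<times> multi_indices k m). f (lex_index (Suc k) m l))"
    unfolding multi_indices_def sum.cartesian_product
    by (subst sum.reindex[OF inj_combinator]) (auto intro!: sum.cong)
  also have "(\<lambda>(y, l). l(k := y)) ` ({..<m k} \<times> multi_indices k m) = multi_indices (Suc k) m"
    by (simp add: multi_indices_def lessThan_Suc PiE_insert_eq)
  finally show ?case .
qed

section \<open>Expectation values of diagonal matrices in product vectors\<close>

lemma tensor_vec_lex_index:
  assumes "\<forall>r<k. \<phi> r \<in> carrier_vec (m r)" "\<forall>r<k. l r < m r"
  shows "tensor_vec k \<phi> $ lex_index k m l = (\<Prod>r<k. \<phi> r $ l r)"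
  using assms
proof (induction k)
  case (Suc k)
  have v: "dim_vec (tensor_vec k \<phi>) = tensor_dim k m" "dim_vec (\<phi> k) = m k"
    using Suc.prems tensor_vec_carrier[of k \<phi> m] by auto
  have "kron_vec (tensor_vec k \<phi>) (\<phi> k) $ (lex_index k m l * dim_vec (\<phi> k) + l k) =
      tensor_vec k \<phi> $ lex_index k m l * \<phi> k $ l k"
    using v Suc.prems lex_index_less[of k l m] by (intro kron_vec_index) auto
  then show ?case
    using Suc v by simp
qed simp

text \<open>Each coordinate of a product vector is a product of coordinates of its factors, so its
  squared modulus is a product weight.\<close>

lemma braket_diagonal_tensor_vec:
  assumes "diagonal_mat S" "S \<in> carrier_mat (tensor_dim k m) (tensor_dim k m)"
    and \<phi>: "\<forall>r<k. \<phi> r \<in> carrier_vec (m r)"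
  shows "braket (tensor_vec k \<phi>) S (tensor_vec k \<phi>) =
    (\<Sum>l\<in>multi_indices k m. complex_of_real (\<Prod>r<k. (cmod (\<phi> r $ l r))\<^sup>2) *
      S $$ (lex_index k m l, lex_index k m l))"
proof -
  have "tensor_vec k \<phi> $ lex_index k m l = (\<Prod>r<k. \<phi> r $ l r)" if "l \<in> multi_indices k m" for l
    using \<phi> that by (intro tensor_vec_lex_index) (auto simp: multi_indices_def)
  then show ?thesis
    unfolding braket_diagonal[OF assms(1,2) tensor_vec_carrier[OF \<phi>]] sum_lex_index
    by (intro sum.cong refl) (simp add: prod_power_distrib prod_norm[symmetric])
qed

text \<open>Identifies the numbers \<open>lam l\<close> of the theorem with diagonal entries: for a
  basis ket the product weights reduce to a Kronecker delta.\<close>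

lemma braket_diagonal_product_ket:
  assumes "diagonal_mat S" "S \<in> carrier_mat (tensor_dim k m) (tensor_dim k m)"
    and l: "l \<in> multi_indices k m"
  shows "braket (product_ket k m l) S (product_ket k m l) =
    S $$ (lex_index k m l, lex_index k m l)"
proof -
  have weight: "(\<Prod>r<k. (cmod (unit_vec (m r) (l r) $ l' r))\<^sup>2) = (if l' = l then 1 else 0)"
    if l': "l' \<in> multi_indices k m" for l'
  proof (cases "l' = l")
    case True
    then show ?thesis
      using l by (auto simp: multi_indices_def PiE_iff intro!: prod.neutral)
  next
    case False
    \<comment> \<open>Multi-indices are extensional functions, so distinct ones differ at some
      \<open>r < k\<close>, and the weight factor at that \<open>r\<close> vanishes.\<close>
    then obtain r where "r < k" "l' r \<noteq> l r"
      using l l' unfolding multi_indices_def by (metis PiE_ext lessThan_iff)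
    then show ?thesis
      using l l' False by (auto simp: multi_indices_def PiE_iff intro!: prod_zero bexI[of _ r])
  qed
  have fin: "finite (multi_indices k m)"
    by (simp add: multi_indices_def finite_PiE)
  have "braket (product_ket k m l) S (product_ket k m l) =
      (\<Sum>l'\<in>multi_indices k m. if l' = l then S $$ (lex_index k m l, lex_index k m l) else 0)"
    unfolding product_ket_def using assms(1,2)
    by (subst braket_diagonal_tensor_vec) (auto simp: weight simp del: of_real_prod intro!: sum.cong)
  then show ?thesis
    using fin l by simp
qed

subsection \<open>Product numerical ranges\<close>

lemma product_numerical_range_conjugate:
  assumes A: "A \<in> carrier_mat (tensor_dim k m) (tensor_dim k m)"
    and U: "\<forall>r<k. unitary_mat (m r) (U r)"
  shows "product_numerical_range k m (tensor_mat k U * A * mat_adjoint (tensor_mat k U)) =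
    product_numerical_range k m A" (is "product_numerical_range k m ?S = _")
proof -
  have carr: "\<forall>r<k. U r \<in> carrier_mat (m r) (m r)"
    using U by (simp add: unitary_mat_def)
  have br: "braket (tensor_vec k \<phi>) ?S (tensor_vec k \<phi>) =
      braket (tensor_vec k (\<lambda>r. mat_adjoint (U r) *\<^sub>v \<phi> r)) A
        (tensor_vec k (\<lambda>r. mat_adjoint (U r) *\<^sub>v \<phi> r))"
    if "\<forall>r<k. \<phi> r \<in> carrier_vec (m r)" for \<phi>
  proof -
    have "mat_adjoint (tensor_mat k U) *\<^sub>v tensor_vec k \<phi> =
        tensor_vec k (\<lambda>r. mat_adjoint (U r) *\<^sub>v \<phi> r)"
      unfolding mat_adjoint_tensor_mat using carr that
      by (intro tensor_mat_mult_tensor_vec) auto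
    then show ?thesis
      using braket_conjugate_mat[OF tensor_mat_carrier[OF carr] A tensor_vec_carrier[OF that]]
      by simp
  qed
  have unit: "V *\<^sub>v v \<in> carrier_vec n \<and> cvec_norm (V *\<^sub>v v) = 1"
    if "unitary_mat n V" "v \<in> carrier_vec n" "cvec_norm v = 1" for n V v
    using that by (auto simp: cvec_norm_unitary unitary_mat_def)
  show ?thesis
  proof (intro equalityI subsetI)
    fix z assume "z \<in> product_numerical_range k m ?S"
    then obtain \<phi> where \<phi>: "\<forall>r<k. \<phi> r \<in> carrier_vec (m r) \<and> cvec_norm (\<phi> r) = 1"
      and z: "z = braket (tensor_vec k \<phi>) ?S (tensor_vec k \<phi>)"
      by (auto simp: product_numerical_range_def)
    define \<psi> where "\<psi> = (\<lambda>r. mat_adjoint (U r) *\<^sub>v \<phi> r)"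
    have "z = braket (tensor_vec k \<psi>) A (tensor_vec k \<psi>)"
      using z br \<phi> by (simp add: \<psi>_def)
    moreover have "\<forall>r<k. \<psi> r \<in> carrier_vec (m r) \<and> cvec_norm (\<psi> r) = 1"
      unfolding \<psi>_def using U \<phi>
      by (blast intro: unit[THEN conjunct1] unit[THEN conjunct2] unitary_mat_adjoint)
    ultimately show "z \<in> product_numerical_range k m A"
      by (auto simp: product_numerical_range_def)
  next
    fix z assume "z \<in> product_numerical_range k m A"
    then obtain \<psi> where \<psi>: "\<forall>r<k. \<psi> r \<in> carrier_vec (m r) \<and> cvec_norm (\<psi> r) = 1"
      and z: "z = braket (tensor_vec k \<psi>) A (tensor_vec k \<psi>)"
      by (auto simp: product_numerical_range_def)
    \<comment> \<open>The inverse of the substitution in \<open>br\<close>: applying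
      \<open>mat_adjoint (U r)\<close> to \<open>\<phi> r\<close> gives back
      \<open>\<psi> r\<close>.\<close>
    define \<phi> where "\<phi> = (\<lambda>r. U r *\<^sub>v \<psi> r)"
    have \<phi>: "\<forall>r<k. \<phi> r \<in> carrier_vec (m r) \<and> cvec_norm (\<phi> r) = 1"
      unfolding \<phi>_def using U \<psi>
      by (blast intro: unit[THEN conjunct1] unit[THEN conjunct2])
    have "mat_adjoint (U r) *\<^sub>v \<phi> r = \<psi> r" if "r < k" for r
      using U \<psi> that unfolding \<phi>_def unitary_mat_def
      by (subst assoc_mult_mat_vec[symmetric, of _ "m r" "m r" _ "m r"]) auto
    \<comment> \<open>The factors are known to agree only for \<open>r < k\<close>, and
      \<open>tensor_vec k\<close> reads no others.\<close>
    then have "tensor_vec k (\<lambda>r. mat_adjoint (U r) *\<^sub>v \<phi> r) = tensor_vec k \<psi>"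
      by (rule tensor_vec_cong)
    then have "z = braket (tensor_vec k \<phi>) ?S (tensor_vec k \<phi>)"
      using z br \<phi> by simp
    then show "z \<in> product_numerical_range k m ?S"
      using \<phi> by (auto simp: product_numerical_range_def)
  qed
qed

lemma product_numerical_range_diagonal:
  assumes "diagonal_mat S" "S \<in> carrier_mat (tensor_dim k m) (tensor_dim k m)"
  shows "product_numerical_range k m S =
    {(\<Sum>l\<in>multi_indices k m. complex_of_real (\<Prod>r<k. p r (l r)) *
        S $$ (lex_index k m l, lex_index k m l)) | p :: nat \<Rightarrow> nat \<Rightarrow> real.
       \<forall>r<k. (\<forall>i<m r. 0 \<le> p r i) \<and> (\<Sum>i<m r. p r i) = 1}" (is "_ = ?R")
proof (intro equalityI subsetI)
  fix z assume "z \<in> product_numerical_range k m S"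
  then obtain \<phi> where \<phi>: "\<forall>r<k. \<phi> r \<in> carrier_vec (m r) \<and> cvec_norm (\<phi> r) = 1"
    and z: "z = braket (tensor_vec k \<phi>) S (tensor_vec k \<phi>)"
    by (auto simp: product_numerical_range_def)
  \<comment> \<open>Unit norm makes the squared moduli of the coordinates a probability vector,
    which becomes the witness for \<open>p r\<close>.\<close>
  have "(\<Sum>i<m r. (cmod (\<phi> r $ i))\<^sup>2) = 1" if "r < k" for r
    using \<phi> that by (auto simp: cvec_norm_def)
  then show "z \<in> ?R"
    using z \<phi> assms by (auto simp: braket_diagonal_tensor_vec intro!: exI[of _ "\<lambda>r i. (cmod (\<phi> r $ i))\<^sup>2"])
next
  fix z assume "z \<in> ?R"
  then obtain p :: "nat \<Rightarrow> nat \<Rightarrow> real"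
    where p: "\<forall>r<k. (\<forall>i<m r. 0 \<le> p r i) \<and> (\<Sum>i<m r. p r i) = 1"
      and z: "z = (\<Sum>l\<in>multi_indices k m. complex_of_real (\<Prod>r<k. p r (l r)) *
        S $$ (lex_index k m l, lex_index k m l))"
    by blast
  \<comment> \<open>Only moduli of coordinates enter the weights, so real amplitudes suffice;
    nonnegativity of \<open>p r i\<close> makes the square root recover it.\<close>
  define \<phi> where "\<phi> = (\<lambda>r. vec (m r) (\<lambda>i. complex_of_real (sqrt (p r i))))"
  have \<phi>p: "(cmod (\<phi> r $ i))\<^sup>2 = p r i" if "r < k" "i < m r" for r i
    using p that by (simp add: \<phi>_def)
  have \<phi>: "\<forall>r<k. \<phi> r \<in> carrier_vec (m r)"
    by (simp add: \<phi>_def)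
  have "\<forall>r<k. cvec_norm (\<phi> r) = 1"
  proof (intro allI impI)
    fix r assume "r < k"
    then have "(\<Sum>i<m r. (cmod (\<phi> r $ i))\<^sup>2) = 1"
      using p \<phi>p by simp
    then show "cvec_norm (\<phi> r) = 1"
      by (simp add: cvec_norm_def \<phi>_def)
  qed
  \<comment> \<open>Every multi-index satisfies \<open>l r < m r\<close>, so \<open>\<phi>p\<close>
    rewrites each factor of each weight.\<close>
  moreover have "z = braket (tensor_vec k \<phi>) S (tensor_vec k \<phi>)"
    unfolding z braket_diagonal_tensor_vec[OF assms \<phi>]
    by (intro sum.cong refl arg_cong2[where f = "(*)"] arg_cong[where f = of_real] prod.cong)
      (auto simp: \<phi>p multi_indices_def PiE_iff)
  ultimately show "z \<in> product_numerical_range k m S"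
    using \<phi> by (auto simp: product_numerical_range_def)
qed

theorem proposition6:
  fixes k :: nat and m :: "nat \<Rightarrow> nat"
    and A S :: "complex mat" and U :: "nat \<Rightarrow> complex mat"
    and lam :: "(nat \<Rightarrow> nat) \<Rightarrow> complex"
  assumes "A \<in> carrier_mat (tensor_dim k m) (tensor_dim k m)"
    and "product_diagonalizable k m A"
    and "product_diagonalizes k m U A S"
    and "\<And>l. l \<in> multi_indices k m \<Longrightarrow>
           lam l = braket (product_ket k m l) S (product_ket k m l)"
  shows "product_numerical_range k m A =
    {(\<Sum>l\<in>multi_indices k m. complex_of_real (\<Prod>r<k. p r (l r)) * lam l) | p :: nat \<Rightarrow> nat \<Rightarrow> real.
       \<forall>r<k. (\<forall>i<m r. 0 \<le> p r i) \<and> (\<Sum>i<m r. p r i) = 1}"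
proof -
  have U: "\<forall>r<k. unitary_mat (m r) (U r)" and diag: "diagonal_mat S"
    and S: "S = tensor_mat k U * A * mat_adjoint (tensor_mat k U)"
    using assms(3) by (auto simp: product_diagonalizes_def)
  have "tensor_mat k U \<in> carrier_mat (tensor_dim k m) (tensor_dim k m)"
    using U by (intro tensor_mat_carrier) (simp add: unitary_mat_def)
  then have carr: "S \<in> carrier_mat (tensor_dim k m) (tensor_dim k m)"
    using assms(1) unfolding S by auto
  \<comment> \<open>The values of \<open>lam\<close> are prescribed on
    \<open>multi_indices k m\<close> only, which is where the sums read them.\<close>
  have "lam l = S $$ (lex_index k m l, lex_index k m l)" if "l \<in> multi_indices k m" for l
    using assms(4)[OF that] braket_diagonal_product_ket[OF diag carr that] by simp
  then have "(\<Sum>l\<in>multi_indices k m. complex_of_real (\<Prod>r<k. p r (l r)) * lam l) =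
      (\<Sum>l\<in>multi_indices k m. complex_of_real (\<Prod>r<k. p r (l r)) *
        S $$ (lex_index k m l, lex_index k m l))" for p :: "nat \<Rightarrow> nat \<Rightarrow> real"
    by simp
  \<comment> \<open>Conjugation invariance replaces \<open>A\<close> by \<open>S\<close>, to which
    the description for diagonal matrices applies.\<close>
  then show ?thesis
    using product_numerical_range_conjugate[OF assms(1) U] product_numerical_range_diagonal[OF diag carr]
    unfolding S by simp
qed

end
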